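(* Every weakly unital category is centralic.
   Context: A pointed category is a category with a zero object $0$; zero morphisms are also denoted $0$. A pointed finitely complete category is weakly unital if for any two objects $X,Y$ the product inclusions $(1_X,0)\colon X\to X\times Y$ and $(0,1_Y)\colon Y\to X\times Y$ are jointly epimorphic. For morphisms $x\colon S\to X$, $y\colon S\to Y$, $f\colon X\times Y\to Z$, write $f(x,y)$ for the composite $f\circ(x,y)\colon S\to Z$. A pointed category with finite products is called centralic if for every morphism $f\colon X\times Y\to Z$, every object $S$ and all morphisms $x,x'\colon S\to X$, $y\colon S\to Y$: $f(x,0)=f(x',0)$ implies $f(x,y)=f(x',y)$. *)

theory Defs
  imports Main
begin

record ('o, 'm) cat =
  Obj :: "'o set"
  Arr :: "'m set"
  Dom :: "'m \<Rightarrow> 'o"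
  Cod :: "'m \<Rightarrow> 'o"
  Id :: "'o \<Rightarrow> 'm"
  Comp :: "'m \<Rightarrow> 'm \<Rightarrow> 'm"  (infixl "\<cdot>\<index>" 70)

text \<open>Composition is written in applicative order: \<open>g \<cdot> f\<close> is ``first \<open>f\<close>, then \<open>g\<close>''.\<close>

definition hom :: "('o, 'm) cat \<Rightarrow> 'o \<Rightarrow> 'o \<Rightarrow> 'm set" where
  "hom C X Y = {f \<in> Arr C. Dom C f = X \<and> Cod C f = Y}"

locale category =
  fixes C :: "('o, 'm) cat" (structure)
  assumes Dom_in_Obj: "f \<in> Arr C \<Longrightarrow> Dom C f \<in> Obj C"
    and Cod_in_Obj: "f \<in> Arr C \<Longrightarrow> Cod C f \<in> Obj C"
    and Id_in_hom: "X \<in> Obj C \<Longrightarrow> Id C X \<in> hom C X X"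
    and Comp_in_hom: "f \<in> hom C X Y \<Longrightarrow> g \<in> hom C Y Z \<Longrightarrow> g \<cdot> f \<in> hom C X Z"
    and Comp_Id: "f \<in> hom C X Y \<Longrightarrow> f \<cdot> Id C X = f"
    and Id_Comp: "f \<in> hom C X Y \<Longrightarrow> Id C Y \<cdot> f = f"
    and Comp_assoc: "f \<in> hom C W X \<Longrightarrow> g \<in> hom C X Y \<Longrightarrow> h \<in> hom C Y Z \<Longrightarrow>
      (h \<cdot> g) \<cdot> f = h \<cdot> (g \<cdot> f)"

definition is_functor ::
  "('i, 'a) cat \<Rightarrow> ('o, 'm) cat \<Rightarrow> ('i \<Rightarrow> 'o) \<Rightarrow> ('a \<Rightarrow> 'm) \<Rightarrow> bool" where
  "is_functor J C F\<^sub>o F\<^sub>a \<longleftrightarrow> category J \<and> category C \<and>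
     (\<forall>i \<in> Obj J. F\<^sub>o i \<in> Obj C) \<and>
     (\<forall>i j. \<forall>u \<in> hom J i j. F\<^sub>a u \<in> hom C (F\<^sub>o i) (F\<^sub>o j)) \<and>
     (\<forall>i \<in> Obj J. F\<^sub>a (Id J i) = Id C (F\<^sub>o i)) \<and>
     (\<forall>i j k. \<forall>u \<in> hom J i j. \<forall>v \<in> hom J j k. F\<^sub>a (v \<cdot>\<^bsub>J\<^esub> u) = F\<^sub>a v \<cdot>\<^bsub>C\<^esub> F\<^sub>a u)"

definition is_cone ::
  "('i, 'a) cat \<Rightarrow> ('o, 'm) cat \<Rightarrow> ('i \<Rightarrow> 'o) \<Rightarrow> ('a \<Rightarrow> 'm) \<Rightarrow> 'o \<Rightarrow> ('i \<Rightarrow> 'm) \<Rightarrow> bool" where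
  "is_cone J C F\<^sub>o F\<^sub>a S s \<longleftrightarrow> S \<in> Obj C \<and>
     (\<forall>i \<in> Obj J. s i \<in> hom C S (F\<^sub>o i)) \<and>
     (\<forall>i j. \<forall>u \<in> hom J i j. F\<^sub>a u \<cdot>\<^bsub>C\<^esub> s i = s j)"

definition is_limit ::
  "('i, 'a) cat \<Rightarrow> ('o, 'm) cat \<Rightarrow> ('i \<Rightarrow> 'o) \<Rightarrow> ('a \<Rightarrow> 'm) \<Rightarrow> 'o \<Rightarrow> ('i \<Rightarrow> 'm) \<Rightarrow> bool" where
  "is_limit J C F\<^sub>o F\<^sub>a L p \<longleftrightarrow> is_cone J C F\<^sub>o F\<^sub>a L p \<and>
     (\<forall>S s. is_cone J C F\<^sub>o F\<^sub>a S s \<longrightarrow>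
        (\<exists>!h. h \<in> hom C S L \<and> (\<forall>i \<in> Obj J. p i \<cdot>\<^bsub>C\<^esub> h = s i)))"

text \<open>Every finite category is isomorphic to one whose objects and arrows are natural numbers,
  so these are the only diagram shapes needed.\<close>

definition finitely_complete :: "('o, 'm) cat \<Rightarrow> bool" where
  "finitely_complete C \<longleftrightarrow> category C \<and>
     (\<forall>(J :: (nat, nat) cat) F\<^sub>o F\<^sub>a. finite (Obj J) \<and> finite (Arr J) \<and> is_functor J C F\<^sub>o F\<^sub>a \<longrightarrow>
        (\<exists>L p. is_limit J C F\<^sub>o F\<^sub>a L p))"

definition is_product ::
  "('o, 'm) cat \<Rightarrow> 'i set \<Rightarrow> ('i \<Rightarrow> 'o) \<Rightarrow> 'o \<Rightarrow> ('i \<Rightarrow> 'm) \<Rightarrow> bool" where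
  "is_product C I X P p \<longleftrightarrow> P \<in> Obj C \<and> (\<forall>i \<in> I. p i \<in> hom C P (X i)) \<and>
     (\<forall>S \<in> Obj C. \<forall>s. (\<forall>i \<in> I. s i \<in> hom C S (X i)) \<longrightarrow>
        (\<exists>!h. h \<in> hom C S P \<and> (\<forall>i \<in> I. p i \<cdot>\<^bsub>C\<^esub> h = s i)))"

definition has_finite_products :: "('o, 'm) cat \<Rightarrow> bool" where
  "has_finite_products C \<longleftrightarrow> category C \<and>
     (\<forall>(I :: nat set) X. finite I \<and> (\<forall>i \<in> I. X i \<in> Obj C) \<longrightarrow> (\<exists>P p. is_product C I X P p))"

definition is_binary_product ::
  "('o, 'm) cat \<Rightarrow> 'o \<Rightarrow> 'o \<Rightarrow> 'o \<Rightarrow> 'm \<Rightarrow> 'm \<Rightarrow> bool" where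
  "is_binary_product C X Y P p q \<longleftrightarrow> P \<in> Obj C \<and> p \<in> hom C P X \<and> q \<in> hom C P Y \<and>
     (\<forall>S \<in> Obj C. \<forall>x \<in> hom C S X. \<forall>y \<in> hom C S Y.
        (\<exists>!h. h \<in> hom C S P \<and> p \<cdot>\<^bsub>C\<^esub> h = x \<and> q \<cdot>\<^bsub>C\<^esub> h = y))"

text \<open>The morphism \<open>(x, y) : S \<rightarrow> P\<close> into a product \<open>P\<close> with projections \<open>p\<close> and \<open>q\<close>; meaningful
  only if \<open>p\<close>, \<open>q\<close> form a binary product cone and \<open>x\<close>, \<open>y\<close> have a common domain.\<close>

definition pair_arr :: "('o, 'm) cat \<Rightarrow> 'm \<Rightarrow> 'm \<Rightarrow> 'm \<Rightarrow> 'm \<Rightarrow> 'm" where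
  "pair_arr C p q x y =
     (THE h. h \<in> hom C (Dom C x) (Dom C p) \<and> p \<cdot>\<^bsub>C\<^esub> h = x \<and> q \<cdot>\<^bsub>C\<^esub> h = y)"

definition is_zero_object :: "('o, 'm) cat \<Rightarrow> 'o \<Rightarrow> bool" where
  "is_zero_object C Z \<longleftrightarrow> Z \<in> Obj C \<and>
     (\<forall>X \<in> Obj C. (\<exists>!f. f \<in> hom C X Z) \<and> (\<exists>!f. f \<in> hom C Z X))"

definition pointed :: "('o, 'm) cat \<Rightarrow> bool" where
  "pointed C \<longleftrightarrow> category C \<and> (\<exists>Z. is_zero_object C Z)"

text \<open>In a pointed category the composite below is the same for every choice of zero object.\<close>

definition zero_arr :: "('o, 'm) cat \<Rightarrow> 'o \<Rightarrow> 'o \<Rightarrow> 'm" where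
  "zero_arr C X Y =
     (THE f. \<exists>Z g h. is_zero_object C Z \<and> g \<in> hom C X Z \<and> h \<in> hom C Z Y \<and> f = h \<cdot>\<^bsub>C\<^esub> g)"

definition jointly_epimorphic :: "('o, 'm) cat \<Rightarrow> 'm \<Rightarrow> 'm \<Rightarrow> bool" where
  "jointly_epimorphic C f g \<longleftrightarrow> f \<in> Arr C \<and> g \<in> Arr C \<and> Cod C f = Cod C g \<and>
     (\<forall>Z \<in> Obj C. \<forall>u \<in> hom C (Cod C f) Z. \<forall>v \<in> hom C (Cod C f) Z.
        u \<cdot>\<^bsub>C\<^esub> f = v \<cdot>\<^bsub>C\<^esub> f \<and> u \<cdot>\<^bsub>C\<^esub> g = v \<cdot>\<^bsub>C\<^esub> g \<longrightarrow> u = v)"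

text \<open>No choice of products is part of the structure: the next two conditions are imposed on every
  product cone, which amounts to imposing them on one product of each pair of objects, since
  products are unique up to an isomorphism compatible with the projections.\<close>

definition weakly_unital :: "('o, 'm) cat \<Rightarrow> bool" where
  "weakly_unital C \<longleftrightarrow> pointed C \<and> finitely_complete C \<and>
     (\<forall>X \<in> Obj C. \<forall>Y \<in> Obj C. \<forall>P p q. is_binary_product C X Y P p q \<longrightarrow>
        jointly_epimorphic C
          (pair_arr C p q (Id C X) (zero_arr C X Y))
          (pair_arr C p q (zero_arr C Y X) (Id C Y)))"

definition centralic :: "('o, 'm) cat \<Rightarrow> bool" where
  "centralic C \<longleftrightarrow> pointed C \<and> has_finite_products C \<and>
     (\<forall>X \<in> Obj C. \<forall>Y \<in> Obj C. \<forall>P p q. is_binary_product C X Y P p q \<longrightarrow>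
        (\<forall>Z \<in> Obj C. \<forall>f \<in> hom C P Z. \<forall>S \<in> Obj C.
          \<forall>x \<in> hom C S X. \<forall>x' \<in> hom C S X. \<forall>y \<in> hom C S Y.
            f \<cdot>\<^bsub>C\<^esub> pair_arr C p q x (zero_arr C S Y) = f \<cdot>\<^bsub>C\<^esub> pair_arr C p q x' (zero_arr C S Y) \<longrightarrow>
            f \<cdot>\<^bsub>C\<^esub> pair_arr C p q x y = f \<cdot>\<^bsub>C\<^esub> pair_arr C p q x' y))"

end

theory Submission
  imports Defs
begin

text \<open>
  Suppose \<open>f(x, 0) = f(x', 0)\<close>, where \<open>f : X \<times> Y \<rightarrow> Z\<close>, \<open>x, x' : S \<rightarrow> X\<close> and \<open>y : S \<rightarrow> Y\<close>. Replace
  \<open>y\<close> by the generic morphism into \<open>Y\<close>: the two morphisms \<open>f \<cdot> (x \<times> 1)\<close> and \<open>f \<cdot> (x' \<times> 1)\<close> from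
  \<open>S \<times> Y\<close> to \<open>Z\<close> give \<open>f(x, y)\<close> and \<open>f(x', y)\<close> when composed with \<open>(1, y) : S \<rightarrow> S \<times> Y\<close>, so it is
  enough that they are equal. Along the inclusion \<open>(1, 0)\<close> of \<open>S\<close> they restrict to \<open>f(x, 0)\<close> and
  \<open>f(x', 0)\<close>, which agree by assumption; along the inclusion \<open>(0, 1)\<close> of \<open>Y\<close> both restrict to
  \<open>f(0, 1)\<close>, because \<open>x \<cdot> 0 = 0 = x' \<cdot> 0\<close>. As the two inclusions into \<open>S \<times> Y\<close> are jointly
  epimorphic, the morphisms are equal.

  Apart from this argument (\<open>weakly_unital_cancel\<close>), the proof has to supply the product
  \<open>S \<times> Y\<close>. It is a limit over a discrete category (\<open>finitely_complete_imp_has_finite_products\<close>).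
\<close>

section \<open>Zero morphisms\<close>

text \<open>Two factorizations through zero objects \<open>Z\<close> and \<open>Z'\<close> have the same composite, because both
  are compatible with the unique morphism \<open>Z \<rightarrow> Z'\<close>.\<close>

lemma (in category) zero_factorization_unique:
  assumes Z: "is_zero_object C Z" and Z': "is_zero_object C Z'"
    and g: "g \<in> hom C X Z" and h: "h \<in> hom C Z Y"
    and g': "g' \<in> hom C X Z'" and h': "h' \<in> hom C Z' Y"
  shows "h \<cdot> g = h' \<cdot> g'"
proof -
  have X: "X \<in> Obj C" and Y: "Y \<in> Obj C"
    using g h Dom_in_Obj Cod_in_Obj by (auto simp: hom_def)
  obtain k where k: "k \<in> hom C Z Z'"
    using Z Z' unfolding is_zero_object_def by (metis (no_types))
  have "k \<cdot> g = g'"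
    using Z' X g' Comp_in_hom[OF g k] unfolding is_zero_object_def by (metis (no_types))
  moreover have "h' \<cdot> k = h"
    using Z Y h Comp_in_hom[OF k h'] unfolding is_zero_object_def by (metis (no_types))
  ultimately show ?thesis
    using Comp_assoc[OF g k h'] by simp
qed

lemma (in category) zero_arr_eq:
  assumes "is_zero_object C Z" "g \<in> hom C X Z" "h \<in> hom C Z Y"
  shows "zero_arr C X Y = h \<cdot> g"
  unfolding zero_arr_def
proof (rule the_equality)
  show "\<exists>Z g' h'. is_zero_object C Z \<and> g' \<in> hom C X Z \<and> h' \<in> hom C Z Y \<and> h \<cdot> g = h' \<cdot> g'"
    using assms by blast
next
  fix f
  assume "\<exists>Z g h. is_zero_object C Z \<and> g \<in> hom C X Z \<and> h \<in> hom C Z Y \<and> f = h \<cdot> g"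
  then obtain Z' g' h' where "is_zero_object C Z'" "g' \<in> hom C X Z'" "h' \<in> hom C Z' Y"
    and f: "f = h' \<cdot> g'"
    by blast
  then show "f = h \<cdot> g"
    unfolding f using assms by (intro zero_factorization_unique)
qed

lemma (in category) zero_arr_factors:
  assumes "pointed C" "X \<in> Obj C" "Y \<in> Obj C"
  obtains Z g h where "is_zero_object C Z" "g \<in> hom C X Z" "h \<in> hom C Z Y"
    "zero_arr C X Y = h \<cdot> g"
proof -
  obtain Z where Z: "is_zero_object C Z"
    using assms(1) unfolding pointed_def by blast
  obtain g h where "g \<in> hom C X Z" "h \<in> hom C Z Y"
    using Z assms(2,3) unfolding is_zero_object_def by (metis (no_types))
  then show thesis
    using that[OF Z] zero_arr_eq[OF Z] by simp
qed

lemma (in category) zero_arr_in_hom: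
  assumes "pointed C" "X \<in> Obj C" "Y \<in> Obj C"
  shows "zero_arr C X Y \<in> hom C X Y"
  using zero_arr_factors[OF assms] Comp_in_hom by metis

lemma (in category) Comp_zero_arr:
  assumes "pointed C" "W \<in> Obj C" "x \<in> hom C X Y"
  shows "x \<cdot> zero_arr C W X = zero_arr C W Y"
proof -
  have X: "X \<in> Obj C"
    using assms(3) Dom_in_Obj by (auto simp: hom_def)
  obtain Z g h where Z: "is_zero_object C Z" and g: "g \<in> hom C W Z" and h: "h \<in> hom C Z X"
    and eq: "zero_arr C W X = h \<cdot> g"
    using zero_arr_factors[OF assms(1,2) X] .
  have "zero_arr C W Y = (x \<cdot> h) \<cdot> g"
    using zero_arr_eq[OF Z g Comp_in_hom[OF h assms(3)]] .
  then show ?thesis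
    using Comp_assoc[OF g h assms(3)] eq by simp
qed

section \<open>Morphisms into binary products\<close>

lemma (in category) pair_arr_eqI:
  assumes P: "is_binary_product C X Y P p q" and h: "h \<in> hom C S P"
    and x: "p \<cdot> h = x" and y: "q \<cdot> h = y"
  shows "pair_arr C p q x y = h"
proof -
  have p: "p \<in> hom C P X" and q: "q \<in> hom C P Y"
    using P unfolding is_binary_product_def by auto
  have S: "S \<in> Obj C"
    using h Dom_in_Obj by (auto simp: hom_def)
  have xy: "x \<in> hom C S X" "y \<in> hom C S Y"
    using Comp_in_hom h p q x y by blast+
  then have "\<exists>!h. h \<in> hom C S P \<and> p \<cdot> h = x \<and> q \<cdot> h = y"
    using P S unfolding is_binary_product_def by blast
  moreover have "Dom C x = S" "Dom C p = P"
    using xy p by (auto simp: hom_def)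
  ultimately show ?thesis
    unfolding pair_arr_def using h x y by (auto intro: the1_equality)
qed

lemma (in category) pair_arr_in_hom_proj:
  assumes P: "is_binary_product C X Y P p q" and x: "x \<in> hom C S X" and y: "y \<in> hom C S Y"
  shows "pair_arr C p q x y \<in> hom C S P"
    and "p \<cdot> pair_arr C p q x y = x"
    and "q \<cdot> pair_arr C p q x y = y"
proof -
  have "S \<in> Obj C"
    using x Dom_in_Obj by (auto simp: hom_def)
  then obtain h where h: "h \<in> hom C S P" "p \<cdot> h = x" "q \<cdot> h = y"
    using P x y unfolding is_binary_product_def by blast
  then have "pair_arr C p q x y = h"
    by (rule pair_arr_eqI[OF P])
  with h show "pair_arr C p q x y \<in> hom C S P"
    and "p \<cdot> pair_arr C p q x y = x"
    and "q \<cdot> pair_arr C p q x y = y"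
    by simp_all
qed

lemma (in category) pair_arr_Comp:
  assumes P: "is_binary_product C X Y P p q" and x: "x \<in> hom C S X" and y: "y \<in> hom C S Y"
    and t: "t \<in> hom C T S"
  shows "pair_arr C p q x y \<cdot> t = pair_arr C p q (x \<cdot> t) (y \<cdot> t)"
proof -
  note xy = pair_arr_in_hom_proj[OF P x y]
  have p: "p \<in> hom C P X" and q: "q \<in> hom C P Y"
    using P unfolding is_binary_product_def by auto
  show ?thesis
    using pair_arr_eqI[OF P Comp_in_hom[OF t xy(1)] refl refl]
      Comp_assoc[OF t xy(1) p] Comp_assoc[OF t xy(1) q] xy(2,3) by simp
qed

text \<open>The identity \<open>(x \<times> 1)(a, b) = (x a, b)\<close>, with \<open>x \<times> 1 : S \<times> Y \<rightarrow> X \<times> Y\<close> written out as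
  \<open>(x \<cdot> r, s)\<close> for the projections \<open>r\<close> and \<open>s\<close> of \<open>S \<times> Y\<close>.\<close>

lemma (in category) times_Id_Comp_pair_arr:
  assumes P: "is_binary_product C X Y P p q" and Q: "is_binary_product C S Y Q r s"
    and x: "x \<in> hom C S X" and a: "a \<in> hom C T S" and b: "b \<in> hom C T Y"
  shows "pair_arr C p q (x \<cdot> r) s \<cdot> pair_arr C r s a b = pair_arr C p q (x \<cdot> a) b"
proof -
  have r: "r \<in> hom C Q S" and s: "s \<in> hom C Q Y"
    using Q unfolding is_binary_product_def by auto
  note ab = pair_arr_in_hom_proj[OF Q a b]
  show ?thesis
    using pair_arr_Comp[OF P Comp_in_hom[OF r x] s ab(1)] Comp_assoc[OF ab(1) r x] ab(2,3)
    by simp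
qed

section \<open>Finite products from finite limits\<close>

definition discrete_cat :: "'i set \<Rightarrow> ('i, 'i) cat" where
  "discrete_cat I =
     \<lparr>Obj = I, Arr = I, Dom = \<lambda>i. i, Cod = \<lambda>i. i, Id = \<lambda>i. i, Comp = \<lambda>g f. f\<rparr>"

lemma discrete_cat_simps [simp]:
  "Obj (discrete_cat I) = I" "Arr (discrete_cat I) = I"
  "Id (discrete_cat I) i = i" "Comp (discrete_cat I) j i = i"
  "u \<in> hom (discrete_cat I) i j \<longleftrightarrow> u \<in> I \<and> u = i \<and> u = j"
  by (auto simp: discrete_cat_def hom_def)

lemma category_discrete_cat: "category (discrete_cat I)"
  by unfold_locales (auto simp: discrete_cat_def hom_def)

lemma (in category) is_functor_discrete_cat:
  assumes "\<forall>i \<in> I. X i \<in> Obj C"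
  shows "is_functor (discrete_cat I) C X (\<lambda>i. Id C (X i))"
  unfolding is_functor_def
  using assms category_discrete_cat category_axioms
  by (auto simp: Id_in_hom Comp_Id[OF Id_in_hom])

lemma (in category) is_cone_discrete_cat:
  "is_cone (discrete_cat I) C X (\<lambda>i. Id C (X i)) S s \<longleftrightarrow>
     S \<in> Obj C \<and> (\<forall>i \<in> I. s i \<in> hom C S (X i))"
  unfolding is_cone_def by (auto simp: Id_Comp[of _ S])

lemma (in category) is_product_if_is_limit_discrete:
  assumes "is_limit (discrete_cat I) C X (\<lambda>i. Id C (X i)) P p"
  shows "is_product C I X P p"
  using assms unfolding is_limit_def is_product_def is_cone_discrete_cat by auto

lemma finitely_complete_imp_has_finite_products:
  assumes "finitely_complete C"
  shows "has_finite_products C"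
proof -
  interpret category C
    using assms by (simp add: finitely_complete_def)
  have "\<exists>P p. is_product C I X P p"
    if "finite I" "\<forall>i \<in> I. X i \<in> Obj C" for I :: "nat set" and X
  proof -
    have "\<exists>P p. is_limit (discrete_cat I) C X (\<lambda>i. Id C (X i)) P p"
      using assms that(1) is_functor_discrete_cat[OF that(2)]
      unfolding finitely_complete_def by (metis discrete_cat_simps(1,2))
    then show ?thesis
      using is_product_if_is_limit_discrete by blast
  qed
  then show ?thesis
    using category_axioms unfolding has_finite_products_def by blast
qed

lemma has_finite_products_imp_binary_product:
  assumes "has_finite_products C" "X \<in> Obj C" "Y \<in> Obj C"
  obtains P p q where "is_binary_product C X Y P p q"
proof -
  define F where "F i = (if i = (0::nat) then X else Y)" for i
  have "\<exists>P p. is_product C {0, 1} F P p"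
    using assms unfolding has_finite_products_def F_def by simp
  then obtain P p where P: "is_product C {0, 1} F P p"
    by blast
  have "is_binary_product C X Y P (p 0) (p 1)"
    unfolding is_binary_product_def
  proof (intro conjI ballI)
    show "P \<in> Obj C" "p 0 \<in> hom C P X" "p 1 \<in> hom C P Y"
      using P by (auto simp: is_product_def F_def)
  next
    fix S x y
    assume S: "S \<in> Obj C" and xy: "x \<in> hom C S X" "y \<in> hom C S Y"
    define s where "s i = (if i = (0::nat) then x else y)" for i
    have "\<forall>i \<in> {0, 1}. s i \<in> hom C S (F i)"
      using xy by (simp add: s_def F_def)
    then have "\<exists>!h. h \<in> hom C S P \<and> (\<forall>i \<in> {0, 1}. p i \<cdot>\<^bsub>C\<^esub> h = s i)"
      using P S unfolding is_product_def by blast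
    then show "\<exists>!h. h \<in> hom C S P \<and> p 0 \<cdot>\<^bsub>C\<^esub> h = x \<and> p 1 \<cdot>\<^bsub>C\<^esub> h = y"
      by (simp add: s_def)
  qed
  then show thesis
    using that by blast
qed

section \<open>Weakly unital categories are centralic\<close>

text \<open>The morphisms \<open>f \<cdot> (x \<times> 1)\<close> and \<open>f \<cdot> (x' \<times> 1)\<close> agree on both inclusions into \<open>S \<times> Y\<close>,
  hence are equal; composing them with \<open>(1, y)\<close> yields the conclusion.\<close>

lemma weakly_unital_cancel:
  fixes C (structure)
  assumes wu: "weakly_unital C"
    and P: "is_binary_product C X Y P p q"
    and f: "f \<in> hom C P Z"
    and x: "x \<in> hom C S X" and x': "x' \<in> hom C S X" and y: "y \<in> hom C S Y"
    and eq: "f \<cdot> pair_arr C p q x (zero_arr C S Y) = f \<cdot> pair_arr C p q x' (zero_arr C S Y)"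
  shows "f \<cdot> pair_arr C p q x y = f \<cdot> pair_arr C p q x' y"
proof -
  have pt: "pointed C" and fc: "finitely_complete C"
    using wu by (auto simp: weakly_unital_def)
  interpret category C
    using pt by (simp add: pointed_def)
  have S: "S \<in> Obj C" and Y: "Y \<in> Obj C" and Z: "Z \<in> Obj C"
    using y f Dom_in_Obj Cod_in_Obj by (auto simp: hom_def)
  obtain Q r s where Q: "is_binary_product C S Y Q r s"
    using has_finite_products_imp_binary_product[OF
        finitely_complete_imp_has_finite_products[OF fc] S Y] .
  have r: "r \<in> hom C Q S" and s: "s \<in> hom C Q Y"
    using Q unfolding is_binary_product_def by auto
  define \<iota>\<^sub>1 where "\<iota>\<^sub>1 = pair_arr C r s (Id C S) (zero_arr C S Y)"
  define \<iota>\<^sub>2 where "\<iota>\<^sub>2 = pair_arr C r s (zero_arr C Y S) (Id C Y)"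
  \<comment> \<open>\<open>u w\<close> is \<open>f \<cdot> (w \<times> 1)\<close>.\<close>
  define u where "u w = f \<cdot> pair_arr C p q (w \<cdot> r) s" for w
  have times: "pair_arr C p q (w \<cdot> r) s \<in> hom C Q P" if "w \<in> hom C S X" for w
    using pair_arr_in_hom_proj(1)[OF P Comp_in_hom[OF r that] s] .
  have u_hom: "u w \<in> hom C Q Z" if "w \<in> hom C S X" for w
    unfolding u_def using Comp_in_hom[OF times[OF that] f] .
  have u_pair: "u w \<cdot> pair_arr C r s a b = f \<cdot> pair_arr C p q (w \<cdot> a) b"
    if "w \<in> hom C S X" "a \<in> hom C T S" "b \<in> hom C T Y" for w a b T
    unfolding u_def
    using Comp_assoc[OF pair_arr_in_hom_proj(1)[OF Q that(2,3)] times[OF that(1)] f]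
      times_Id_Comp_pair_arr[OF P Q that] by simp
  have u1: "u w \<cdot> \<iota>\<^sub>1 = f \<cdot> pair_arr C p q w (zero_arr C S Y)" if "w \<in> hom C S X" for w
    unfolding \<iota>\<^sub>1_def
    using u_pair[OF that Id_in_hom[OF S] zero_arr_in_hom[OF pt S Y]] Comp_Id[OF that] by simp
  have u2: "u w \<cdot> \<iota>\<^sub>2 = f \<cdot> pair_arr C p q (zero_arr C Y X) (Id C Y)" if "w \<in> hom C S X" for w
    unfolding \<iota>\<^sub>2_def
    using u_pair[OF that zero_arr_in_hom[OF pt Y S] Id_in_hom[OF Y]]
      Comp_zero_arr[OF pt Y that] by simp
  have "jointly_epimorphic C \<iota>\<^sub>1 \<iota>\<^sub>2"
    unfolding \<iota>\<^sub>1_def \<iota>\<^sub>2_def using wu S Y Q unfolding weakly_unital_def by blast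
  moreover have "Cod C \<iota>\<^sub>1 = Q"
    using pair_arr_in_hom_proj(1)[OF Q Id_in_hom[OF S] zero_arr_in_hom[OF pt S Y]]
    by (simp add: \<iota>\<^sub>1_def hom_def)
  ultimately have "u x = u x'"
    using u_hom[OF x] u_hom[OF x'] Z u1[OF x] u1[OF x'] u2[OF x] u2[OF x'] eq
    unfolding jointly_epimorphic_def by metis
  moreover have "u w \<cdot> pair_arr C r s (Id C S) y = f \<cdot> pair_arr C p q w y"
    if "w \<in> hom C S X" for w
    using u_pair[OF that Id_in_hom[OF S] y] Comp_Id[OF that] by simp
  ultimately show ?thesis
    using x x' by metis
qed

theorem proposition2p8:
  fixes C :: "('o, 'm) cat"
  assumes "weakly_unital C"
  shows "centralic C"
proof -
  have "pointed C" "has_finite_products C"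
    using assms finitely_complete_imp_has_finite_products by (auto simp: weakly_unital_def)
  then show ?thesis
    unfolding centralic_def using weakly_unital_cancel[OF assms] by blast
qed

end
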